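(* Let $n\ge2$, $o=(o_1,\dots,o_n)\in[0,1]^n$, $c=(\frac1n,\dots,\frac1n)$, $w=(\frac1n,\dots,\frac1n)$, let $\omega\in[0,1]^n$ satisfy $\sum_{k=1}^n\omega_k=1$, and let $\varepsilon,\delta,\gamma_1,\gamma_2\in[0,1]$. Let $\sigma$ be a permutation of $\{1,\dots,n\}$ such that $o_{\sigma(1)}\ge o_{\sigma(2)}\ge\dots\ge o_{\sigma(n)}$, and define $\psi_\omega:[0,1]^n\to[0,1]$ by $\psi_\omega(x)=\sum_{k=1}^n\omega_kx_k$. If $x^*\in[0,1]^n$ solves the linear programming problem $$\min_{x\in[0,1]^n}\ \xi_c^{o_\sigma}(x)\quad\text{subject to}\quad x\in\mathcal{R}_\delta\cap\mathcal{R}_\varepsilon^{\psi_\omega}\cap\mathcal{R}_{\gamma_1}^{w,\psi_\omega}\cap\mathcal{R}_{\gamma_2}^{w},\qquad x_1\ge x_2\ge\dots\ge x_n,$$ then $x^*_{\sigma^{-1}}$ is a solution of the optimization problem $$\min_{x\in[0,1]^n}\ \xi_c^{o}(x)\quad\text{subject to}\quad x\in\mathcal{R}_\delta\cap\mathcal{R}_\varepsilon^{\Psi_\omega}\cap\mathcal{R}_{\gamma_1}^{w,\Psi_\omega}\cap\mathcal{R}_{\gamma_2}^{w}.$$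
   Context: For a vector $y$ of length $n$ and a permutation $\sigma$ of $\{1,\dots,n\}$, $y_\sigma=(y_{\sigma(1)},\dots,y_{\sigma(n)})$. The cost function is $\xi_c^o(x)=\sum_{k=1}^nc_k|x_k-o_k|$. The OWA operator with weights $\omega$ is $\Psi_\omega(x)=\sum_{k=1}^n\omega_kx_{\tau(k)}$, where $\tau$ is a permutation with $x_{\tau(1)}\ge\dots\ge x_{\tau(n)}$. For a function $\Phi:[0,1]^n\to[0,1]$ (here $\Phi=\psi_\omega$ or $\Phi=\Psi_\omega$) and $x\in[0,1]^n$ let $\kappa(x)=\max_{1\le i<j\le n}|x_i-x_j|$, $\kappa^\Phi(x)=\max_{i}|x_i-\Phi(x)|$, $\kappa^{w,\Phi}(x)=\sum_{k=1}^nw_k|x_k-\Phi(x)|$, $\kappa^w(x)=\sum_{k=1}^{n-1}\sum_{l=k+1}^n\frac{w_k+w_l}{n-1}|x_k-x_l|$. Then $\mathcal{R}_\delta=\{x\in[0,1]^n:\kappa(x)\le\delta\}$, $\mathcal{R}_\varepsilon^\Phi=\{x\in[0,1]^n:\kappa^\Phi(x)\le\varepsilon\}$, $\mathcal{R}_\gamma^{w,\Phi}=\{x\in[0,1]^n:\kappa^{w,\Phi}(x)\le\gamma\}$, $\mathcal{R}_\gamma^w=\{x\in[0,1]^n:\kappa^w(x)\le\gamma\}$. *)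

theory Defs
  imports "HOL-Analysis.Analysis" "HOL-Combinatorics.Permutations"
begin

text \<open>
  A vector of length \<open>n\<close> is a function \<open>nat \<Rightarrow> real\<close> whose entries are its values on \<open>{1..n}\<close>.
  Members of the unit cube are extensional, so equality of such functions is equality of vectors,
  and rearrangements along some \<open>\<sigma> permutes {1..n}\<close> (written \<open>y \<circ> \<sigma>\<close>) stay in the cube.
\<close>

definition unit_cube :: "nat \<Rightarrow> (nat \<Rightarrow> real) set" where
  "unit_cube n = {1..n} \<rightarrow>\<^sub>E {0..1}"

definition cost :: "nat \<Rightarrow> (nat \<Rightarrow> real) \<Rightarrow> (nat \<Rightarrow> real) \<Rightarrow> (nat \<Rightarrow> real) \<Rightarrow> real" where
  "cost n c a x = (\<Sum>k = 1..n. c k * \<bar>x k - a k\<bar>)"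

definition weighted_mean :: "nat \<Rightarrow> (nat \<Rightarrow> real) \<Rightarrow> (nat \<Rightarrow> real) \<Rightarrow> real" where
  "weighted_mean n \<omega> x = (\<Sum>k = 1..n. \<omega> k * x k)"

definition sorting_perm :: "nat \<Rightarrow> (nat \<Rightarrow> real) \<Rightarrow> (nat \<Rightarrow> nat) \<Rightarrow> bool" where
  "sorting_perm n x \<tau> \<longleftrightarrow> \<tau> permutes {1..n} \<and> antimono_on {1..n} (x \<circ> \<tau>)"

text \<open>
  A sorting permutation always exists, and the value does not depend on which one is chosen;
  see \<open>sorting_perm_exists\<close> and \<open>owa_eq\<close> below.
\<close>

definition owa :: "nat \<Rightarrow> (nat \<Rightarrow> real) \<Rightarrow> (nat \<Rightarrow> real) \<Rightarrow> real" where
  "owa n \<omega> x = (let \<tau> = (SOME \<tau>. sorting_perm n x \<tau>) in \<Sum>k = 1..n. \<omega> k * x (\<tau> k))"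

definition kappa :: "nat \<Rightarrow> (nat \<Rightarrow> real) \<Rightarrow> real" where
  "kappa n x = Max {\<bar>x i - x j\<bar> | i j. 1 \<le> i \<and> i < j \<and> j \<le> n}"

definition kappa_agg :: "nat \<Rightarrow> ((nat \<Rightarrow> real) \<Rightarrow> real) \<Rightarrow> (nat \<Rightarrow> real) \<Rightarrow> real" where
  "kappa_agg n \<Phi> x = Max ((\<lambda>i. \<bar>x i - \<Phi> x\<bar>) ` {1..n})"

definition kappa_weighted_agg ::
  "nat \<Rightarrow> (nat \<Rightarrow> real) \<Rightarrow> ((nat \<Rightarrow> real) \<Rightarrow> real) \<Rightarrow> (nat \<Rightarrow> real) \<Rightarrow> real" where
  "kappa_weighted_agg n w \<Phi> x = (\<Sum>k = 1..n. w k * \<bar>x k - \<Phi> x\<bar>)"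

definition kappa_weighted :: "nat \<Rightarrow> (nat \<Rightarrow> real) \<Rightarrow> (nat \<Rightarrow> real) \<Rightarrow> real" where
  "kappa_weighted n w x =
     (\<Sum>k = 1..n - 1. \<Sum>l = k + 1..n. (w k + w l) / (real n - 1) * \<bar>x k - x l\<bar>)"

definition R :: "nat \<Rightarrow> real \<Rightarrow> (nat \<Rightarrow> real) set" where
  "R n \<delta> = {x \<in> unit_cube n. kappa n x \<le> \<delta>}"

definition R_agg :: "nat \<Rightarrow> ((nat \<Rightarrow> real) \<Rightarrow> real) \<Rightarrow> real \<Rightarrow> (nat \<Rightarrow> real) set" where
  "R_agg n \<Phi> \<epsilon> = {x \<in> unit_cube n. kappa_agg n \<Phi> x \<le> \<epsilon>}"

definition R_weighted_agg ::
  "nat \<Rightarrow> (nat \<Rightarrow> real) \<Rightarrow> ((nat \<Rightarrow> real) \<Rightarrow> real) \<Rightarrow> real \<Rightarrow> (nat \<Rightarrow> real) set" where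
  "R_weighted_agg n w \<Phi> \<gamma> = {x \<in> unit_cube n. kappa_weighted_agg n w \<Phi> x \<le> \<gamma>}"

definition R_weighted :: "nat \<Rightarrow> (nat \<Rightarrow> real) \<Rightarrow> real \<Rightarrow> (nat \<Rightarrow> real) set" where
  "R_weighted n w \<gamma> = {x \<in> unit_cube n. kappa_weighted n w x \<le> \<gamma>}"

lemma sorting_perm_exists: "\<exists>\<tau>. sorting_perm n x \<tau>"
proof -
  define ys where "ys = rev (sort_key x [1..<n + 1])"
  define \<tau> where "\<tau> = (\<lambda>k. if k \<in> {1..n} then ys ! (k - 1) else k)"
  have ys: "distinct ys" "set ys = {1..n}" "length ys = n"
    by (auto simp: ys_def)
  have "bij_betw (\<lambda>k. k - 1) {1..n} {..<n}"
    by (rule bij_betw_byWitness[where f' = Suc]) auto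
  moreover have "bij_betw ((!) ys) {..<n} {1..n}"
    using ys by (intro bij_betw_nth) auto
  ultimately have "bij_betw ((!) ys \<circ> (\<lambda>k. k - 1)) {1..n} {1..n}"
    by (rule bij_betw_trans)
  then have "bij_betw \<tau> {1..n} {1..n}"
    by (rule bij_betw_cong[THEN iffD1, rotated]) (auto simp: \<tau>_def)
  then have "\<tau> permutes {1..n}"
    by (rule bij_imp_permutes) (auto simp: \<tau>_def)
  moreover have "antimono_on {1..n} (x \<circ> \<tau>)"
  proof (rule monotone_onI)
    fix i j assume ij: "i \<in> {1..n}" "j \<in> {1..n}" "i \<le> j"
    have "sorted (map x (sort_key x [1..<n + 1]))"
      by simp
    then have "sorted (rev (map x ys))"
      by (simp add: ys_def rev_map)
    then have "map x ys ! (j - 1) \<le> map x ys ! (i - 1)"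
      by (rule sorted_rev_nth_mono) (use ij ys in auto)
    then show "(x \<circ> \<tau>) j \<le> (x \<circ> \<tau>) i"
      using ij ys by (auto simp: \<tau>_def)
  qed
  ultimately show ?thesis
    by (auto simp: sorting_perm_def)
qed

lemma owa_eq:
  assumes "sorting_perm n x \<tau>"
  shows "owa n \<omega> x = (\<Sum>k = 1..n. \<omega> k * x (\<tau> k))"
proof -
  define lst where "lst = (\<lambda>\<rho>. map (x \<circ> \<rho>) [1..<n + 1])"
  have sorted: "sorted (rev (lst \<rho>))" if "sorting_perm n x \<rho>" for \<rho>
  proof (rule sorted_rev_iff_nth_mono[THEN iffD2], intro allI impI)
    fix i j assume "i \<le> j" "j < length (lst \<rho>)"
    then show "lst \<rho> ! j \<le> lst \<rho> ! i"
      using that by (auto simp: lst_def sorting_perm_def monotone_on_def simp del: upt_Suc)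
  qed
  have mset: "mset (rev (lst \<rho>)) = image_mset x (mset_set {1..n})" if "sorting_perm n x \<rho>" for \<rho>
  proof -
    have \<rho>: "\<rho> permutes {1..n}"
      using that by (simp add: sorting_perm_def)
    have "mset (rev (lst \<rho>)) = image_mset x (image_mset \<rho> (mset [1..<n + 1]))"
      by (simp add: lst_def multiset.map_comp del: upt_Suc)
    also have "mset [1..<n + 1] = mset_set {1..n}"
      by (simp add: atLeastLessThanSuc_atLeastAtMost del: upt_Suc)
    also have "image_mset \<rho> (mset_set {1..n}) = mset_set {1..n}"
      using \<rho> by (simp add: image_mset_mset_set permutes_inj_on permutes_image)
    finally show ?thesis .
  qed
  define \<tau>' where "\<tau>' = (SOME \<tau>. sorting_perm n x \<tau>)"
  have \<tau>': "sorting_perm n x \<tau>'"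
    unfolding \<tau>'_def using sorting_perm_exists by (rule someI_ex)
  have "sort (rev (lst \<tau>)) = rev (lst \<tau>')"
    using mset[OF assms] mset[OF \<tau>'] sorted[OF \<tau>'] by (intro properties_for_sort) auto
  then have "rev (lst \<tau>) = rev (lst \<tau>')"
    using sorted[OF assms] by (simp add: sorted_sort_id)
  then have "lst \<tau> = lst \<tau>'"
    by simp
  then have "x (\<tau> k) = x (\<tau>' k)" if "k \<in> {1..n}" for k
    using that by (auto simp: lst_def simp del: upt_Suc)
  then show ?thesis
    by (simp add: owa_def Let_def flip: \<tau>'_def)
qed

end

theory Submission
  imports Defs
begin

text \<open>
  With equal weights, the order of the entries matters to the linear program only through the
  weighted mean: once the aggregated value is fixed, all four consensus measures are invariant under
  permutations of the entries. If \<open>\<tau>\<close> sorts \<open>z\<close> decreasingly, the OWA operator at \<open>z\<close> has the value of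
  the weighted mean at \<open>z \<circ> \<tau>\<close>. Hence \<open>z\<close> is feasible for the OWA problem iff its decreasing
  rearrangement \<open>z \<circ> \<tau>\<close> is feasible for the linear program (\<open>feasible_sorted_iff\<close>).

  It remains to compare costs. The solution \<open>x\<close> of the linear program, renumbered by \<open>inv \<sigma>\<close>, has
  cost \<open>cost n c (a \<circ> \<sigma>) x\<close>. A competitor \<open>z\<close> yields the competitor \<open>z \<circ> \<tau>\<close> of \<open>x\<close>, and replacing
  \<open>z\<close> and \<open>a\<close> by their decreasing rearrangements does not increase the cost (\<open>cost_sorted_le\<close>).
  This is a rearrangement inequality: the absolute difference favours matching large entries with
  large ones (\<open>sum_sorted_le_sum_permuted\<close>).
\<close>

section \<open>A rearrangement inequality\<close>

text \<open>
  A pairing is uncrossed one index at a time: the greatest index \<open>m\<close> is swapped into place, which by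
  the exchange hypothesis \<open>exch\<close> does not increase the sum, and then \<open>m\<close> can be removed. The
  hypothesis says that the pairing cost \<open>f\<close> is submodular (the Monge property).
\<close>

lemma sum_sorted_le_sum_permuted:
  fixes u :: "'i::linorder \<Rightarrow> 'a::order" and v :: "'i \<Rightarrow> 'b::order"
    and f :: "'a \<Rightarrow> 'b \<Rightarrow> 'c::ordered_ab_group_add"
  assumes exch: "\<And>p q r s. p \<le> q \<Longrightarrow> r \<le> s \<Longrightarrow> f p r + f q s \<le> f p s + f q r"
    and "finite S" "antimono_on S u" "antimono_on S v" "\<pi> permutes S"
  shows "(\<Sum>k\<in>S. f (u k) (v k)) \<le> (\<Sum>k\<in>S. f (u (\<pi> k)) (v k))"
  using assms(2-)
proof (induction S arbitrary: \<pi> rule: finite_linorder_max_induct)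
  case empty
  then show ?case by simp
next
  case (insert m S)
  define i where "i = inv \<pi> m"
  define \<rho> where "\<rho> = \<pi> \<circ> Transposition.transpose i m"
  have \<pi>i: "\<pi> i = m"
    unfolding i_def using insert.prems(3) by (rule permutes_inverses)
  have i: "i \<in> insert m S"
    unfolding i_def using permutes_in_image[OF permutes_inv[OF insert.prems(3)], of m] by simp
  have \<pi>m: "\<pi> m \<in> insert m S"
    using permutes_in_image[OF insert.prems(3), of m] by simp
  have "m \<notin> S"
    using insert.hyps(2) by blast
  have "\<rho> permutes insert m S"
    unfolding \<rho>_def using i insert.prems(3) by (intro permutes_compose permutes_swap_id) auto
  moreover have \<rho>m: "\<rho> m = m"
    by (simp add: \<rho>_def \<pi>i)
  ultimately have \<rho>: "\<rho> permutes S"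
    using \<open>m \<notin> S\<close> by (auto simp: permutes_def)
  have "(\<Sum>k\<in>S. f (u k) (v k)) \<le> (\<Sum>k\<in>S. f (u (\<rho> k)) (v k))"
    using insert.prems(1,2) \<rho> by (intro insert.IH) (auto intro: monotone_on_subset)
  then have "(\<Sum>k\<in>insert m S. f (u k) (v k)) \<le> (\<Sum>k\<in>insert m S. f (u (\<rho> k)) (v k))"
    using insert.hyps(1) \<open>m \<notin> S\<close> \<rho>m by simp
  also have "\<dots> \<le> (\<Sum>k\<in>insert m S. f (u (\<pi> k)) (v k))"
  proof (cases "i = m")
    case True
    then show ?thesis by (simp add: \<rho>_def)
  next
    case False
    define T where "T = S - {i}"
    have parts: "insert m S = insert m (insert i T)" "m \<notin> insert i T" "i \<notin> T" "finite T"
      using False i \<open>m \<notin> S\<close> insert.hyps(1) by (auto simp: T_def)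
    have rest: "(\<Sum>k\<in>T. f (u (\<rho> k)) (v k)) = (\<Sum>k\<in>T. f (u (\<pi> k)) (v k))"
      using parts by (intro sum.cong) (auto simp: \<rho>_def Transposition.transpose_def)
    have le_m: "k \<le> m" if "k \<in> insert m S" for k
      using insert.hyps(2) that by (auto intro: less_imp_le)
    have "f (u m) (v m) + f (u (\<pi> m)) (v i) \<le> f (u m) (v i) + f (u (\<pi> m)) (v m)"
      using insert.prems(1,2) le_m i \<pi>m by (intro exch) (auto simp: monotone_on_def)
    then have "(f (u m) (v m) + f (u (\<pi> m)) (v i)) + (\<Sum>k\<in>T. f (u (\<pi> k)) (v k))
        \<le> (f (u m) (v i) + f (u (\<pi> m)) (v m)) + (\<Sum>k\<in>T. f (u (\<pi> k)) (v k))"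
      by (rule add_right_mono)
    moreover have "\<rho> i = \<pi> m"
      by (simp add: \<rho>_def)
    then have "(\<Sum>k\<in>insert m S. f (u (\<rho> k)) (v k))
        = (f (u m) (v m) + f (u (\<pi> m)) (v i)) + (\<Sum>k\<in>T. f (u (\<pi> k)) (v k))"
      unfolding parts(1) using parts(2-) by (simp add: rest \<rho>m add.assoc)
    moreover have "(\<Sum>k\<in>insert m S. f (u (\<pi> k)) (v k))
        = (f (u m) (v i) + f (u (\<pi> m)) (v m)) + (\<Sum>k\<in>T. f (u (\<pi> k)) (v k))"
      unfolding parts(1) using parts(2-) by (simp add: \<pi>i add.assoc add.left_commute)
    ultimately show ?thesis
      by (simp only:)
  qed
  finally show ?case .
qed

section \<open>Invariance under renumbering\<close>

lemma cost_renumber: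
  assumes "\<pi> permutes {1..n}"
  shows "cost n (c \<circ> \<pi>) (a \<circ> \<pi>) (y \<circ> \<pi>) = cost n c a y"
  unfolding cost_def
  using sum.permute[OF assms, of "\<lambda>k. c k * \<bar>y k - a k\<bar>"] by (simp add: o_def)

lemma unit_cube_renumber:
  assumes "\<pi> permutes {1..n}"
  shows "y \<circ> \<pi> \<in> unit_cube n \<longleftrightarrow> y \<in> unit_cube n"
proof -
  have *: "z \<circ> \<rho> \<in> unit_cube n" if "z \<in> unit_cube n" "\<rho> permutes {1..n}" for z \<rho>
    unfolding unit_cube_def
  proof (rule PiE_I)
    fix k assume "k \<in> {1..n}"
    then have "\<rho> k \<in> {1..n}"
      using that(2) by (simp only: permutes_in_image)
    then show "(z \<circ> \<rho>) k \<in> {0..1}"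
      using that(1) unfolding unit_cube_def o_apply by (rule PiE_mem[rotated])
  next
    fix k assume k: "k \<notin> {1..n}"
    then have "\<rho> k = k"
      using that(2) by (rule permutes_not_in[rotated])
    then show "(z \<circ> \<rho>) k = undefined"
      using PiE_arb[OF that(1)[unfolded unit_cube_def] k] by simp
  qed
  have "(y \<circ> \<pi>) \<circ> inv \<pi> = y"
    by (simp add: o_assoc[symmetric] permutes_inv_o(1)[OF assms])
  then have "y \<in> unit_cube n" if "y \<circ> \<pi> \<in> unit_cube n"
    using *[OF that permutes_inv[OF assms]] by (simp only:)
  then show ?thesis
    using * assms by blast
qed

lemma kappa_renumber:
  assumes "\<pi> permutes {1..n}"
  shows "kappa n (y \<circ> \<pi>) = kappa n y"
proof -
  define D where "D = {(i, j). i \<in> {1..n} \<and> j \<in> {1..n} \<and> i \<noteq> j}"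
  \<comment> \<open>Ordered pairs of distinct indices, unlike pairs \<open>i < j\<close>, are permuted by \<open>\<pi>\<close>.\<close>
  have pairs: "{\<bar>z i - z j\<bar> | i j. 1 \<le> i \<and> i < j \<and> j \<le> n} = (\<lambda>(i, j). \<bar>z i - z j\<bar>) ` D"
    for z :: "nat \<Rightarrow> real"
  proof (intro equalityI subsetI)
    fix r assume "r \<in> (\<lambda>(i, j). \<bar>z i - z j\<bar>) ` D"
    then obtain i j where ij: "i \<in> {1..n}" "j \<in> {1..n}" "i \<noteq> j" "r = \<bar>z i - z j\<bar>"
      by (auto simp: D_def)
    show "r \<in> {\<bar>z i - z j\<bar> | i j. 1 \<le> i \<and> i < j \<and> j \<le> n}"
    proof (cases "i < j")
      case True
      then show ?thesis using ij by auto
    next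
      case False
      then have "r = \<bar>z j - z i\<bar> \<and> 1 \<le> j \<and> j < i \<and> i \<le> n" using ij by auto
      then show ?thesis by blast
    qed
  qed (force simp: D_def)
  have "map_prod \<pi> \<pi> ` D = D"
  proof (intro equalityI subsetI)
    fix p assume "p \<in> D"
    then obtain i j where ij: "p = (i, j)" "i \<in> {1..n}" "j \<in> {1..n}" "i \<noteq> j"
      by (auto simp: D_def)
    have "p = map_prod \<pi> \<pi> (inv \<pi> i, inv \<pi> j)"
      using ij permutes_inverses(1)[OF assms] by simp
    moreover have "(inv \<pi> i, inv \<pi> j) \<in> D"
      using ij permutes_in_image[OF permutes_inv[OF assms]] permutes_inverses(1)[OF assms]
      unfolding D_def by (metis (mono_tags, lifting) case_prodI mem_Collect_eq)
    ultimately show "p \<in> map_prod \<pi> \<pi> ` D" by blast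
  next
    fix p assume "p \<in> map_prod \<pi> \<pi> ` D"
    then obtain i j where ij: "p = (\<pi> i, \<pi> j)" "i \<in> {1..n}" "j \<in> {1..n}" "i \<noteq> j"
      by (auto simp: D_def)
    then show "p \<in> D"
      using permutes_in_image[OF assms] permutes_inverses(2)[OF assms]
      unfolding D_def by (metis (mono_tags, lifting) case_prodI mem_Collect_eq)
  qed
  then have "(\<lambda>(i, j). \<bar>y i - y j\<bar>) ` D = (\<lambda>(i, j). \<bar>y i - y j\<bar>) ` map_prod \<pi> \<pi> ` D"
    by simp
  also have "\<dots> = (\<lambda>(i, j). \<bar>(y \<circ> \<pi>) i - (y \<circ> \<pi>) j\<bar>) ` D"
    by (simp add: image_image case_prod_unfold)
  finally show ?thesis
    unfolding kappa_def pairs by (simp only:)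
qed

lemma kappa_agg_renumber:
  assumes "\<pi> permutes {1..n}" "\<Phi> (y \<circ> \<pi>) = \<Psi> y"
  shows "kappa_agg n \<Phi> (y \<circ> \<pi>) = kappa_agg n \<Psi> y"
proof -
  have "(\<lambda>i. \<bar>(y \<circ> \<pi>) i - \<Phi> (y \<circ> \<pi>)\<bar>) ` {1..n} = (\<lambda>i. \<bar>y i - \<Psi> y\<bar>) ` \<pi> ` {1..n}"
    by (simp add: image_image assms(2))
  then show ?thesis
    by (simp only: kappa_agg_def permutes_image[OF assms(1)])
qed

lemma kappa_weighted_agg_renumber:
  assumes "\<pi> permutes {1..n}" "\<Phi> (y \<circ> \<pi>) = \<Psi> y"
  shows "kappa_weighted_agg n (w \<circ> \<pi>) \<Phi> (y \<circ> \<pi>) = kappa_weighted_agg n w \<Psi> y"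
  unfolding kappa_weighted_agg_def assms(2)
  using sum.permute[OF assms(1), of "\<lambda>k. w k * \<bar>y k - \<Psi> y\<bar>"] by (simp add: o_def)

text \<open>
  Since each term is symmetric in the pair of indices and vanishes on the diagonal, the sum over
  unordered pairs is half the sum over the whole square, on which renumbering is visibly harmless.
\<close>

lemma kappa_weighted_square:
  "2 * kappa_weighted n w y =
     (\<Sum>k = 1..n. \<Sum>l = 1..n. (w k + w l) / (real n - 1) * \<bar>y k - y l\<bar>)"
proof -
  define g where "g k l = (w k + w l) / (real n - 1) * \<bar>y k - y l\<bar>" for k l
  have g: "g k l = g l k" "g k k = 0" for k l
    by (simp_all add: g_def add.commute abs_minus_commute)
  define U where "U = (\<Sum>k = 1..n. \<Sum>l = 1..n. if k < l then g k l else 0)"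
  have "kappa_weighted n w y = (\<Sum>k = 1..n - 1. \<Sum>l = k + 1..n. g k l)"
    by (simp add: kappa_weighted_def g_def)
  \<comment> \<open>The row \<open>k = n\<close> may be added because it is empty.\<close>
  also have "\<dots> = (\<Sum>k = 1..n. \<Sum>l = k + 1..n. g k l)"
    by (rule sum.mono_neutral_left) auto
  also have "\<dots> = U"
    unfolding U_def
  proof (rule sum.cong[OF refl])
    fix k assume "k \<in> {1..n}"
    then have "{l \<in> {1..n}. k < l} = {k + 1..n}"
      by auto
    then show "(\<Sum>l = k + 1..n. g k l) = (\<Sum>l = 1..n. if k < l then g k l else 0)"
      by (simp add: sum.inter_filter[symmetric])
  qed
  finally have U: "kappa_weighted n w y = U" .
  have "(\<Sum>k = 1..n. \<Sum>l = 1..n. g k l) =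
      U + (\<Sum>k = 1..n. \<Sum>l = 1..n. if l < k then g k l else 0)"
    unfolding U_def sum.distrib[symmetric]
    by (intro sum.cong refl) (auto simp: g(2) not_less dest: antisym)
  also have "(\<Sum>k = 1..n. \<Sum>l = 1..n. if l < k then g k l else 0) = U"
    unfolding U_def by (subst sum.swap) (simp add: g(1) cong: if_cong)
  finally show ?thesis
    using U by (simp add: g_def)
qed

lemma kappa_weighted_renumber:
  assumes "\<pi> permutes {1..n}"
  shows "kappa_weighted n (w \<circ> \<pi>) (y \<circ> \<pi>) = kappa_weighted n w y"
proof -
  define g where "g k l = (w k + w l) / (real n - 1) * \<bar>y k - y l\<bar>" for k l
  have "2 * kappa_weighted n (w \<circ> \<pi>) (y \<circ> \<pi>) = (\<Sum>k = 1..n. \<Sum>l = 1..n. g (\<pi> k) (\<pi> l))"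
    by (simp add: kappa_weighted_square g_def)
  also have "\<dots> = (\<Sum>k = 1..n. \<Sum>l = 1..n. g (\<pi> k) l)"
    by (intro sum.cong refl sum.permute[OF assms, unfolded o_def, symmetric])
  also have "\<dots> = (\<Sum>k = 1..n. \<Sum>l = 1..n. g k l)"
    using sum.permute[OF assms, of "\<lambda>k. \<Sum>l = 1..n. g k l"] by (simp add: o_def)
  also have "\<dots> = 2 * kappa_weighted n w y"
    by (simp add: kappa_weighted_square g_def)
  finally show ?thesis by simp
qed

section \<open>Comparing the two problems\<close>

lemma weight_renumber_const:
  assumes "\<pi> permutes {1..n}" "\<forall>k\<in>{1..n}. w k = d"
  shows "\<forall>k\<in>{1..n}. (w \<circ> \<pi>) k = w k"
  using assms(2) permutes_in_image[OF assms(1)] unfolding o_apply by metis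

text \<open>
  Sorting translates the constraints of the OWA problem into those of the linear program. The
  weights have to be equal because sorting would otherwise attach them to other entries.
\<close>

lemma feasible_sorted_iff:
  assumes \<tau>: "sorting_perm n z \<tau>" and w: "\<forall>k\<in>{1..n}. w k = d"
  shows "z \<circ> \<tau> \<in> R n \<delta> \<inter> R_agg n (weighted_mean n \<omega>) \<epsilon>
           \<inter> R_weighted_agg n w (weighted_mean n \<omega>) \<gamma>\<^sub>1 \<inter> R_weighted n w \<gamma>\<^sub>2
     \<longleftrightarrow> z \<in> R n \<delta> \<inter> R_agg n (owa n \<omega>) \<epsilon>
           \<inter> R_weighted_agg n w (owa n \<omega>) \<gamma>\<^sub>1 \<inter> R_weighted n w \<gamma>\<^sub>2"
proof -
  have p: "\<tau> permutes {1..n}"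
    using \<tau> by (simp add: sorting_perm_def)
  have \<Phi>: "weighted_mean n \<omega> (z \<circ> \<tau>) = owa n \<omega> z"
    by (simp add: weighted_mean_def owa_eq[OF \<tau>])
  have w\<tau>: "(w \<circ> \<tau>) k = w k" if "k \<in> {1..n}" for k
    using weight_renumber_const[OF p w] that by blast
  have "kappa_weighted_agg n w (weighted_mean n \<omega>) (z \<circ> \<tau>)
      = kappa_weighted_agg n (w \<circ> \<tau>) (weighted_mean n \<omega>) (z \<circ> \<tau>)"
    unfolding kappa_weighted_agg_def by (intro sum.cong) (simp_all only: w\<tau>)
  then have wa: "kappa_weighted_agg n w (weighted_mean n \<omega>) (z \<circ> \<tau>)
      = kappa_weighted_agg n w (owa n \<omega>) z"
    by (simp only: kappa_weighted_agg_renumber[where \<Phi> = "weighted_mean n \<omega>"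
          and y = z and \<Psi> = "owa n \<omega>", OF p \<Phi>])
  have "2 * kappa_weighted n w (z \<circ> \<tau>) = 2 * kappa_weighted n (w \<circ> \<tau>) (z \<circ> \<tau>)"
    unfolding kappa_weighted_square by (intro sum.cong refl) (simp only: w\<tau>)
  then have "kappa_weighted n w (z \<circ> \<tau>) = kappa_weighted n w z"
    by (simp add: kappa_weighted_renumber[OF p])
  then show ?thesis
    using wa
    by (simp add: R_def R_agg_def R_weighted_agg_def R_weighted_def unit_cube_renumber[OF p]
        kappa_renumber[OF p] kappa_agg_renumber[where \<Phi> = "weighted_mean n \<omega>"
          and y = z and \<Psi> = "owa n \<omega>", OF p \<Phi>])
qed

lemma cost_renumber_const:
  assumes "\<pi> permutes {1..n}" "\<forall>k\<in>{1..n}. c k = d"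
  shows "cost n c (a \<circ> \<pi>) (y \<circ> \<pi>) = cost n c a y"
proof -
  have "cost n c (a \<circ> \<pi>) (y \<circ> \<pi>) = cost n (c \<circ> \<pi>) (a \<circ> \<pi>) (y \<circ> \<pi>)"
    unfolding cost_def using weight_renumber_const[OF assms] by (intro sum.cong refl) metis
  then show ?thesis
    by (simp add: cost_renumber[OF assms(1)])
qed

text \<open>
  Renumbering by \<open>\<sigma>\<close> turns the pairing of \<open>z\<close> with \<open>a\<close> into a pairing of \<open>z \<circ> \<sigma>\<close>, a rearrangement
  of the decreasing \<open>z \<circ> \<tau>\<close>, with the decreasing \<open>a \<circ> \<sigma>\<close>; uncrossing that pairing only helps.
\<close>

lemma cost_sorted_le:
  assumes \<sigma>: "sorting_perm n a \<sigma>" and \<tau>: "sorting_perm n z \<tau>"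
    and c: "\<forall>k\<in>{1..n}. c k = d" and "d \<ge> 0"
  shows "cost n c (a \<circ> \<sigma>) (z \<circ> \<tau>) \<le> cost n c a z"
proof -
  have p: "\<sigma> permutes {1..n}" "\<tau> permutes {1..n}"
    and mono: "antimono_on {1..n} (a \<circ> \<sigma>)" "antimono_on {1..n} (z \<circ> \<tau>)"
    using \<sigma> \<tau> by (auto simp: sorting_perm_def)
  have cost: "cost n c b y = d * (\<Sum>k\<in>{1..n}. \<bar>y k - b k\<bar>)" for b y
    using c by (simp add: cost_def sum_distrib_left)
  have perm: "inv \<tau> \<circ> \<sigma> permutes {1..n}"
    using p by (intro permutes_compose permutes_inv)
  have "(\<Sum>k\<in>{1..n}. \<bar>(z \<circ> \<tau>) k - (a \<circ> \<sigma>) k\<bar>)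
      \<le> (\<Sum>k\<in>{1..n}. \<bar>(z \<circ> \<tau>) ((inv \<tau> \<circ> \<sigma>) k) - (a \<circ> \<sigma>) k\<bar>)"
    by (rule sum_sorted_le_sum_permuted[where f = "\<lambda>p r. \<bar>p - r\<bar>",
          OF _ finite_atLeastAtMost mono(2,1) perm]) linarith
  also have "\<dots> = (\<Sum>k\<in>{1..n}. \<bar>(z \<circ> \<sigma>) k - (a \<circ> \<sigma>) k\<bar>)"
    by (simp add: permutes_inverses(1)[OF p(2)])
  finally have "cost n c (a \<circ> \<sigma>) (z \<circ> \<tau>) \<le> cost n c (a \<circ> \<sigma>) (z \<circ> \<sigma>)"
    unfolding cost using \<open>d \<ge> 0\<close> by (rule mult_left_mono)
  then show ?thesis
    by (simp add: cost_renumber_const[OF p(1) c])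
qed

theorem theorem4:
  fixes n :: nat
    and a c w \<omega> x :: "nat \<Rightarrow> real"
    and \<epsilon> \<delta> \<gamma>\<^sub>1 \<gamma>\<^sub>2 :: real
    and \<sigma> :: "nat \<Rightarrow> nat"
  assumes "n \<ge> 2"
    and "a \<in> unit_cube n"
    and "\<forall>k\<in>{1..n}. c k = 1 / real n"
    and "\<forall>k\<in>{1..n}. w k = 1 / real n"
    and "\<omega> \<in> unit_cube n"
    and "(\<Sum>k = 1..n. \<omega> k) = 1"
    and "\<epsilon> \<in> {0..1}" and "\<delta> \<in> {0..1}" and "\<gamma>\<^sub>1 \<in> {0..1}" and "\<gamma>\<^sub>2 \<in> {0..1}"
    and "\<sigma> permutes {1..n}"
    and "antimono_on {1..n} (a \<circ> \<sigma>)"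
    and "is_arg_min (cost n c (a \<circ> \<sigma>))
           (\<lambda>y. y \<in> unit_cube n
              \<and> y \<in> R n \<delta> \<inter> R_agg n (weighted_mean n \<omega>) \<epsilon>
                    \<inter> R_weighted_agg n w (weighted_mean n \<omega>) \<gamma>\<^sub>1 \<inter> R_weighted n w \<gamma>\<^sub>2
              \<and> antimono_on {1..n} y) x"
  shows "is_arg_min (cost n c a)
           (\<lambda>y. y \<in> unit_cube n
              \<and> y \<in> R n \<delta> \<inter> R_agg n (owa n \<omega>) \<epsilon>
                    \<inter> R_weighted_agg n w (owa n \<omega>) \<gamma>\<^sub>1 \<inter> R_weighted n w \<gamma>\<^sub>2) (x \<circ> inv \<sigma>)"
proof -
  let ?LP = "\<lambda>y. y \<in> unit_cube n
      \<and> y \<in> R n \<delta> \<inter> R_agg n (weighted_mean n \<omega>) \<epsilon>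
            \<inter> R_weighted_agg n w (weighted_mean n \<omega>) \<gamma>\<^sub>1 \<inter> R_weighted n w \<gamma>\<^sub>2
      \<and> antimono_on {1..n} y"
  let ?OWA = "\<lambda>y. y \<in> unit_cube n
      \<and> y \<in> R n \<delta> \<inter> R_agg n (owa n \<omega>) \<epsilon>
            \<inter> R_weighted_agg n w (owa n \<omega>) \<gamma>\<^sub>1 \<inter> R_weighted n w \<gamma>\<^sub>2"
  note c = assms(3) and w = assms(4) and p = assms(11)
  have LP_iff: "?LP (z \<circ> \<tau>) \<longleftrightarrow> ?OWA z" if "sorting_perm n z \<tau>" for z \<tau>
    using feasible_sorted_iff[OF that w] that unit_cube_renumber[of \<tau> n z]
    unfolding sorting_perm_def by blast
  have \<sigma>: "sorting_perm n a \<sigma>"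
    using assms(11,12) by (simp add: sorting_perm_def)
  have min: "cost n c (a \<circ> \<sigma>) x \<le> cost n c (a \<circ> \<sigma>) y" if "?LP y" for y
    using assms(13) that unfolding is_arg_min_linorder by blast
  have LPx: "?LP x"
    using assms(13) unfolding is_arg_min_linorder by blast
  have x: "(x \<circ> inv \<sigma>) \<circ> \<sigma> = x"
    by (simp add: o_assoc[symmetric] permutes_inv_o(2)[OF p])
  have "sorting_perm n (x \<circ> inv \<sigma>) \<sigma>"
    unfolding sorting_perm_def x using p LPx by blast
  then have "?OWA (x \<circ> inv \<sigma>)"
    using LP_iff LPx x by metis
  moreover have "cost n c a (x \<circ> inv \<sigma>) \<le> cost n c a z" if "?OWA z" for z
  proof -
    obtain \<tau> where \<tau>: "sorting_perm n z \<tau>"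
      using sorting_perm_exists by blast
    have "cost n c a (x \<circ> inv \<sigma>) = cost n c (a \<circ> \<sigma>) x"
      using cost_renumber_const[OF p c, of a "x \<circ> inv \<sigma>"] x by simp
    also have "\<dots> \<le> cost n c (a \<circ> \<sigma>) (z \<circ> \<tau>)"
      using LP_iff[OF \<tau>] that by (intro min) blast
    also have "\<dots> \<le> cost n c a z"
      using \<sigma> \<tau> c by (rule cost_sorted_le) simp
    finally show ?thesis .
  qed
  ultimately show ?thesis
    unfolding is_arg_min_linorder by blast
qed

end
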